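(* Let $\lambda$ be a nonzero real number. For all integers $n\ge k\ge 0$, $$H_{\lambda}(n+1,k)=H_{\lambda}(n,k-1)+(k+n\lambda)H_{\lambda}(n,k).$$
   Context: For $\lambda\in\mathbb{R}$, $\lambda\neq 0$: $\langle x\rangle_{0,\lambda}=1$, $\langle x\rangle_{n,\lambda}=x(x+\lambda)\cdots(x+(n-1)\lambda)$ for $n\ge 1$. The falling factorial is $(x)_0=1$, $(x)_n=x(x-1)\cdots(x-n+1)$ for $n\ge 1$. The heterogeneous Stirling numbers of the second kind $H_\lambda(n,k)$ are defined by the polynomial identity $\langle x\rangle_{n,\lambda}=\sum_{k=0}^{n}H_{\lambda}(n,k)(x)_{k}$ for $n\ge 0$, with $H_\lambda(n,k)=0$ for $k<0$ or $n<k$. *)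

theory Defs
  imports Complex_Main "HOL-Computational_Algebra.Polynomial"
begin

text \<open>Both factorials are polynomials in the indeterminate \<open>x\<close>; \<open>[:a, 1:]\<close> is the linear
  factor \<open>x + a\<close>.\<close>

definition deg_rising :: "real \<Rightarrow> nat \<Rightarrow> real poly" where
  "deg_rising lam n = (\<Prod>i<n. [:real i * lam, 1:])"

definition falling :: "nat \<Rightarrow> real poly" where
  "falling n = (\<Prod>i<n. [:- real i, 1:])"

definition hstirling_row :: "real \<Rightarrow> nat \<Rightarrow> (int \<Rightarrow> real) \<Rightarrow> bool" where
  "hstirling_row lam n h \<longleftrightarrow>
     deg_rising lam n = (\<Sum>k=0..n. smult (h (int k)) (falling k)) \<and>
     (\<forall>k. k < 0 \<or> int n < k \<longrightarrow> h k = 0)"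

text \<open>The second index is an integer, since the value at \<open>-1\<close> is needed. The description
  is well defined by \<open>hstirling_row_ex1\<close> below.\<close>

definition hstirling :: "real \<Rightarrow> nat \<Rightarrow> int \<Rightarrow> real" where
  "hstirling lam n = (THE h. hstirling_row lam n h)"

lemma degree_falling: "degree (falling n) = n"
  unfolding falling_def by (subst degree_prod_eq_sum_degree) auto

lemma lead_coeff_falling: "coeff (falling n) n = 1"
proof -
  have "lead_coeff (falling n) = 1"
    unfolding falling_def by (simp add: lead_coeff_prod)
  then show ?thesis by (simp add: degree_falling)
qed

lemma degree_deg_rising: "degree (deg_rising lam n) = n"
  unfolding deg_rising_def by (subst degree_prod_eq_sum_degree) auto

lemma falling_span:
  fixes p :: "real poly"
  assumes "degree p \<le> n"
  shows "\<exists>c. p = (\<Sum>k=0..n. smult (c k) (falling k))"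
  using assms
proof (induction n arbitrary: p)
  case 0
  then obtain a where "p = [:a:]" by (auto elim: degree_eq_zeroE)
  then have "p = (\<Sum>k=0..0. smult ((\<lambda>_. a) k) (falling k))" by (simp add: falling_def)
  then show ?case by (intro exI[of _ "\<lambda>_. a"]) simp
next
  case (Suc n)
  define q where "q = p - smult (coeff p (Suc n)) (falling (Suc n))"
  have "degree q \<le> n"
  proof (rule degree_le, intro allI impI)
    fix i assume i: "n < i"
    show "coeff q i = 0"
    proof (cases "i = Suc n")
      case True
      then show ?thesis by (simp add: q_def lead_coeff_falling)
    next
      case False
      with i have "Suc n < i" by simp
      then show ?thesis using Suc.prems
        by (simp add: q_def coeff_eq_0 degree_falling)
    qed
  qed
  from Suc.IH[OF this] obtain c where c: "q = (\<Sum>k=0..n. smult (c k) (falling k))" by blast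
  define d where "d = c(Suc n := coeff p (Suc n))"
  have "(\<Sum>k=0..n. smult (d k) (falling k)) = q"
    unfolding c by (rule sum.cong) (auto simp: d_def)
  then have "p = (\<Sum>k=0..Suc n. smult (d k) (falling k))"
    by (simp add: q_def d_def)
  then show ?case by blast
qed

lemma falling_independent:
  assumes "(\<Sum>k=0..n. smult (c k) (falling k)) = 0" "k \<le> n"
  shows "c k = 0"
  using assms
proof (induction n arbitrary: k)
  case 0
  then show ?case by (simp add: falling_def)
next
  case (Suc n)
  have z: "coeff (falling i) (Suc n) = 0" if "i \<le> n" for i
    using that by (intro coeff_eq_0) (simp add: degree_falling)
  have "0 = coeff (\<Sum>k=0..Suc n. smult (c k) (falling k)) (Suc n)"
    using Suc.prems(1) by (metis coeff_0)
  also have "\<dots> = (\<Sum>k=0..n. c k * coeff (falling k) (Suc n)) + c (Suc n)"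
    by (simp add: coeff_sum lead_coeff_falling)
  also have "\<dots> = c (Suc n)"
    by (simp add: z)
  finally have s: "c (Suc n) = 0" by simp
  then have "(\<Sum>k=0..n. smult (c k) (falling k)) = 0" using Suc.prems(1) by simp
  then show ?case using Suc.IH Suc.prems(2) s by (cases "k = Suc n") auto
qed

lemma hstirling_row_ex1: "\<exists>!h. hstirling_row lam n h"
proof (rule ex_ex1I)
  obtain c where c: "deg_rising lam n = (\<Sum>k=0..n. smult (c k) (falling k))"
    using falling_span[of "deg_rising lam n" n] by (auto simp: degree_deg_rising)
  have "hstirling_row lam n (\<lambda>k. if k < 0 \<or> int n < k then 0 else c (nat k))"
    unfolding hstirling_row_def c by (auto intro!: sum.cong)
  then show "\<exists>h. hstirling_row lam n h" by blast
next
  fix g h assume g: "hstirling_row lam n g" and h: "hstirling_row lam n h"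
  have "(\<Sum>k=0..n. smult (g (int k) - h (int k)) (falling k)) = 0"
    using g h unfolding hstirling_row_def by (simp add: smult_diff_left sum_subtractf)
  then have eq: "g (int k) = h (int k)" if "k \<le> n" for k
    using falling_independent[where c = "\<lambda>k. g (int k) - h (int k)" and n = n and k = k] that by simp
  show "g = h"
  proof
    fix k :: int
    show "g k = h k"
    proof (cases "k < 0 \<or> int n < k")
      case True
      then show ?thesis using g h unfolding hstirling_row_def by metis
    next
      case False
      then have "nat k \<le> n" by linarith
      then show ?thesis using eq[of "nat k"] False by simp
    qed
  qed
qed

end

theory Submission
  imports Defs
begin

text \<open>Passing from n to n + 1 multiplies the rising product by x + n*lam. Against the k-th
  falling factorial, write x + n*lam = (x - k) + (k + n*lam): the first part lifts it to the next
  falling factorial, the second only scales it (\<open>falling_mult_linear\<close>). Collecting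
  terms expands the new product (\<open>hstirling_row_Suc\<close>), and uniqueness of such
  expansions gives the recurrence (\<open>hstirling_eqI\<close>).\<close>

lemma falling_mult_linear:
  "falling k * [:a, 1:] = falling (Suc k) + smult (real k + a) (falling k)"
proof -
  have "[:a, 1:] = [:- real k, 1:] + [:real k + a:]" by simp
  then have "falling k * [:a, 1:] = falling k * [:- real k, 1:] + falling k * [:real k + a:]"
    by (simp only: distrib_left)
  then show ?thesis by (simp add: falling_def)
qed

text \<open>Working with whole rows gives all k at once and includes the vanishing outside
  0..n+1.\<close>

lemma hstirling_row_Suc:
  assumes "hstirling_row lam n h"
  shows "hstirling_row lam (Suc n) (\<lambda>k. h (k - 1) + (of_int k + real n * lam) * h k)"
proof -
  have row: "deg_rising lam n = (\<Sum>k=0..n. smult (h (int k)) (falling k))"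
    and zero: "\<And>k. k < 0 \<or> int n < k \<Longrightarrow> h k = 0"
    using assms by (auto simp: hstirling_row_def)
  \<comment> \<open>The term k = 0 drops out because h (-1) = 0.\<close>
  have shift: "(\<Sum>k=0..Suc n. smult (h (int k - 1)) (falling k)) =
      (\<Sum>k=0..n. smult (h (int k)) (falling (Suc k)))"
    by (subst sum.atLeast0_atMost_Suc_shift) (simp add: zero)
  \<comment> \<open>The extra term k = n + 1 drops out because h (n + 1) = 0.\<close>
  have top: "(\<Sum>k=0..Suc n. smult ((real k + real n * lam) * h (int k)) (falling k)) =
      (\<Sum>k=0..n. smult ((real k + real n * lam) * h (int k)) (falling k))"
    by (simp add: zero)
  have "deg_rising lam (Suc n) = deg_rising lam n * [:real n * lam, 1:]"
    by (simp add: deg_rising_def)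
  also have "\<dots> = (\<Sum>k=0..n. smult (h (int k)) (falling k * [:real n * lam, 1:]))"
    unfolding row sum_distrib_right by (simp only: mult_smult_left)
  also have "\<dots> = (\<Sum>k=0..n. smult (h (int k)) (falling (Suc k))) +
      (\<Sum>k=0..n. smult ((real k + real n * lam) * h (int k)) (falling k))"
    by (simp only: falling_mult_linear smult_add_right smult_smult sum.distrib mult.commute)
  also have "\<dots> = (\<Sum>k=0..Suc n.
      smult (h (int k - 1) + (real k + real n * lam) * h (int k)) (falling k))"
    by (simp only: shift[symmetric] top[symmetric] smult_add_left sum.distrib)
  \<comment> \<open>If k < 0 or k > n + 1, then k - 1 and k both lie outside 0..n, so both summands
    vanish.\<close>
  finally show ?thesis
    by (auto simp: hstirling_row_def zero)
qed

lemma hstirling_row_hstirling: "hstirling_row lam n (hstirling lam n)"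
  unfolding hstirling_def by (rule theI'[OF hstirling_row_ex1])

text \<open>This is the comparison of coefficients: \<open>hstirling_row_ex1\<close> allows only one
  row.\<close>

lemma hstirling_eqI: "hstirling_row lam n h \<Longrightarrow> hstirling lam n = h"
  using hstirling_row_ex1 hstirling_row_hstirling by blast

theorem theorem2p5:
  fixes lam :: real and n :: nat and k :: int
  assumes "lam \<noteq> 0" and "0 \<le> k" and "k \<le> int n"
  shows "hstirling lam (n + 1) k =
    hstirling lam n (k - 1) + (of_int k + of_nat n * lam) * hstirling lam n k"
  using hstirling_eqI[OF hstirling_row_Suc[OF hstirling_row_hstirling[of lam n]]] by simp

end
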